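(* Let $k$ be a positive integer and let $E(x,k)=\sum_{n=0}^{\infty}M_n^{(k)}\frac{x^n}{n!}$ be the exponential generating function of the higher order Mersenne numbers. Then $$E(x,k)=\frac{e^{2^kx}-e^{x}}{2^k-1} .$$
   Context: The Mersenne numbers $\{M_n\}_{n\ge 0}$ are defined by $M_0=0$, $M_1=1$, $M_{n+2}=3M_{n+1}-2M_n$, i.e. $M_n=2^n-1$. For a positive integer $k$, the higher order Mersenne numbers are $M_n^{(k)}=M_{kn}/M_k$ for $n=0,1,2,\dots$. *)

theory Defs
  imports Complex_Main
begin

fun mersenne :: "nat \<Rightarrow> int" where
  "mersenne 0 = 0"
| "mersenne (Suc 0) = 1"
| "mersenne (Suc (Suc n)) = 3 * mersenne (Suc n) - 2 * mersenne n"

lemma mersenne_closed_form: "mersenne n = 2 ^ n - 1"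
  by (induction n rule: mersenne.induct) auto

text \<open>The quotient is taken in a field of characteristic 0, so no divisibility
  fact is built into the definition; it is meaningful only for \<open>k > 0\<close>.\<close>
definition higher_mersenne :: "nat \<Rightarrow> nat \<Rightarrow> 'a::field_char_0" where
  "higher_mersenne k n = of_int (mersenne (k * n)) / of_int (mersenne k)"

text \<open>The generating function is read as a convergent power series; the type class
  covers both real and complex arguments.\<close>
definition egf_term :: "'a::{real_normed_field,banach} \<Rightarrow> nat \<Rightarrow> nat \<Rightarrow> 'a" where
  "egf_term x k n = higher_mersenne k n * (x ^ n / fact n)"

definition egf :: "'a::{real_normed_field,banach} \<Rightarrow> nat \<Rightarrow> 'a" where
  "egf x k = (\<Sum>n. egf_term x k n)"

end

theory Submission
  imports Defs
begin

text \<open>By \<open>mersenne_closed_form\<close> the coefficient is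
  \<open>((2 ^ k) ^ n - 1) / (2 ^ k - 1)\<close>, so the series is a constant multiple of the
  difference of the exponential series at \<open>2 ^ k * x\<close> and at \<open>x\<close>. Both
  converge everywhere, hence \<open>egf_term_sums\<close> yields convergence and value at
  once.\<close>

text \<open>Recasts \<open>exp_converges\<close>, phrased with real scaling, in the field division
  used by \<open>egf_term\<close>.\<close>

lemma exp_sums_field:
  fixes x :: "'a::{real_normed_field,banach}"
  shows "(\<lambda>n. x ^ n / fact n) sums exp x"
proof -
  have "x ^ n /\<^sub>R fact n = x ^ n / fact n" for n
    by (simp add: scaleR_conv_of_real divide_inverse mult.commute)
  then show ?thesis
    using exp_converges[of x] by simp
qed

lemma egf_term_sums:
  fixes x :: "'a::{real_normed_field,banach}"
  shows "egf_term x k sums ((exp (2 ^ k * x) - exp x) / (2 ^ k - 1))"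
proof -
  \<comment> \<open>\<open>power_mult\<close> and \<open>power_mult_distrib\<close> absorb
    \<open>2 ^ (k * n)\<close> into the power of \<open>x\<close>.\<close>
  have "egf_term x k n = ((2 ^ k * x) ^ n / fact n - x ^ n / fact n) / (2 ^ k - 1)" for n
    by (simp add: egf_term_def higher_mersenne_def mersenne_closed_form power_mult
        power_mult_distrib diff_divide_distrib algebra_simps)
  then show ?thesis
    using sums_divide[OF sums_diff[OF exp_sums_field[of "2 ^ k * x"] exp_sums_field[of x]]]
    by presburger
qed

theorem theorem2p14:
  fixes k :: nat and x :: "'a::{real_normed_field,banach}"
  assumes "k > 0"
  shows "summable (egf_term x k) \<and> egf x k = (exp (2 ^ k * x) - exp x) / (2 ^ k - 1)"
  using egf_term_sums[of x k] by (auto simp: egf_def sums_iff)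

end
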